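(* Let $Q(x)=x^{2}-px+q$ be a monic quadratic polynomial with complex coefficients and two distinct roots, let $\Delta=p^{2}-4q$ be its discriminant (so that $\Delta=\left(\frac{dQ}{dx}\right)^{2}-4Q$ and $\Delta\neq 0$), and let $F=-\frac{1}{Q}$, viewed as a rational function of $x$. Define rational numbers $\tilde\alpha_{i,n}$ ($0\le i<n$) as the coefficients of the formal power series \[ A(y,z)=\sum_{0\le i<n}\tilde\alpha_{i,n}z^{i}y^{n}=\frac{y}{1-4y}\exp\left\{\frac12 z\left(\frac{1}{\sqrt{1-4y}}-1\right)\right\}. \] Then for every integer $n\ge 1$, \[ F^{n}=\sum_{i=0}^{n-1}\alpha_{i,n}(x)\,\frac{d^{i}F}{dx^{i}},\qquad\text{where}\qquad \alpha_{i,n}(x)=\frac{\left(\frac{dQ}{dx}\right)^{i}}{\Delta^{n-1}}\,\tilde\alpha_{i,n}. \]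
   Context: $\frac{d^{i}F}{dx^{i}}$ denotes the $i$-th derivative of $F$ with respect to $x$. The series $A(y,z)$ is expanded as a formal power series in $y$ and $z$; all its coefficients of $z^{i}y^{n}$ with $i\ge n$ vanish. *)

theory Defs
  imports Complex_Main "HOL-Computational_Algebra.Computational_Algebra"
begin

text \<open>The derivation $d/dx$ on the field of rational functions, given by the quotient rule.
  Independence of the representing fraction is \<open>fract_deriv_Fract\<close> below.\<close>

definition fract_deriv :: "'a::idom poly fract \<Rightarrow> 'a poly fract"
  where "fract_deriv r = (THE s. \<forall>a b. b \<noteq> 0 \<longrightarrow> r = Fraction_Field.Fract a b \<longrightarrow>
    s = Fraction_Field.Fract (pderiv a * b - a * pderiv b) (b * b))"

lemma fract_deriv_Fract:
  fixes a b :: "'a::idom poly"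
  assumes "b \<noteq> 0"
  shows "fract_deriv (Fraction_Field.Fract a b)
       = Fraction_Field.Fract (pderiv a * b - a * pderiv b) (b * b)"
  unfolding fract_deriv_def
proof (rule the_equality)
  show "\<forall>c d. d \<noteq> 0 \<longrightarrow> Fraction_Field.Fract a b = Fraction_Field.Fract c d \<longrightarrow>
    Fraction_Field.Fract (pderiv a * b - a * pderiv b) (b * b)
    = Fraction_Field.Fract (pderiv c * d - c * pderiv d) (d * d)"
  proof (intro allI impI)
    fix c d :: "'a poly"
    assume d: "d \<noteq> 0" and "Fraction_Field.Fract a b = Fraction_Field.Fract c d"
    then have e: "a * d = c * b"
      using assms by (simp add: eq_fract)
    then have "pderiv (a * d) = pderiv (c * b)"
      by simp
    then have e': "pderiv a * d + a * pderiv d = pderiv c * b + c * pderiv b"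
      by (simp add: pderiv_mult algebra_simps)
    have "(pderiv a * b - a * pderiv b) * (d * d) - (pderiv c * d - c * pderiv d) * (b * b)
        = (pderiv a * d + a * pderiv d - (pderiv c * b + c * pderiv b)) * (b * d)
          - (a * d - c * b) * (b * pderiv d + pderiv b * d)"
      by (simp add: algebra_simps)
    also have "\<dots> = 0"
      using e e' by simp
    finally show "Fraction_Field.Fract (pderiv a * b - a * pderiv b) (b * b)
        = Fraction_Field.Fract (pderiv c * d - c * pderiv d) (d * d)"
      using assms d by (simp add: eq_fract)
  qed
qed (use assms in blast)

lemma fract_deriv_to_fract: "fract_deriv (to_fract a) = to_fract (pderiv a)"
  by (simp add: to_fract_def fract_deriv_Fract)

lemma fract_deriv_add: "fract_deriv (r + s) = fract_deriv r + fract_deriv s"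
  by (cases r; cases s) (simp add: fract_deriv_Fract eq_fract pderiv_mult pderiv_add algebra_simps)

lemma fract_deriv_mult: "fract_deriv (r * s) = fract_deriv r * s + r * fract_deriv s"
  by (cases r; cases s) (simp add: fract_deriv_Fract eq_fract pderiv_mult algebra_simps)

definition ratfun_const :: "'a::idom \<Rightarrow> 'a poly fract"
  where "ratfun_const c = to_fract [:c:]"

text \<open>The square root of $1 - 4y$ with constant term $1$.  The first argument of
  \<^const>\<open>fps_radical\<close> only chooses the root of the constant coefficient, here $1$.\<close>

definition sqrt_1_minus_4y :: "rat fps"
  where "sqrt_1_minus_4y = fps_radical (\<lambda>_ _. 1) 2 (1 - 4 * fps_X)"

lemma sqrt_1_minus_4y_nth_0: "sqrt_1_minus_4y $ 0 = 1"
  by (simp add: sqrt_1_minus_4y_def)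

lemma sqrt_1_minus_4y_power2: "sqrt_1_minus_4y ^ 2 = 1 - 4 * fps_X"
  using power_radical[of "1 - 4 * fps_X :: rat fps" "\<lambda>_ _. 1" 1]
  by (simp add: sqrt_1_minus_4y_def numeral_2_eq_2)

text \<open>Elements of $\mathbf{Q}[[y]][[z]]$: the outer series variable is $z$, so the coefficient
  of $z^i y^n$ is \<open>A_series $ i $ n\<close>.  Recall that \<open>fps_exp g\<close> is $\exp(g z)$.\<close>

definition A_exponent :: "rat fps"
  where "A_exponent = fps_const (1 / 2) * (1 / sqrt_1_minus_4y - 1)"

definition A_series :: "rat fps fps"
  where "A_series = fps_const (fps_X / (1 - 4 * fps_X)) * fps_exp A_exponent"

definition alpha_tilde :: "nat \<Rightarrow> nat \<Rightarrow> rat"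
  where "alpha_tilde i n = A_series $ i $ n"

text \<open>In \<open>fps_exp A_exponent\<close>, the quotients by factorials are taken in the ring
  $\mathbf{Q}[[y]]$, where factorials are units.\<close>

lemma A_series_nth:
  "A_series $ i = fps_X / (1 - 4 * fps_X) * (fps_const (1 / fact i) * A_exponent ^ i)"
proof -
  have c: "(of_nat (fact i) :: rat fps) = fps_const (fact i)"
    by (metis fps_of_nat of_nat_fact)
  have "A_exponent ^ i / of_nat (fact i) = fps_const (1 / fact i) * A_exponent ^ i"
    by (simp only: c) (simp add: fps_divide_unit fps_const_inverse inverse_eq_divide mult.commute)
  then show ?thesis
    by (simp add: A_series_def fps_exp_def)
qed

lemma alpha_tilde_eq_0:
  assumes "n \<le> i"
  shows "alpha_tilde i n = 0"
proof -
  have g0: "A_exponent $ 0 = 0"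
    by (simp add: A_exponent_def fps_divide_unit sqrt_1_minus_4y_nth_0)
  have low: "(A_exponent ^ i) $ k = 0" if "k < i" for k
    using startsby_zero_power_prefix[OF g0] that by blast
  have f0: "(fps_X / (1 - 4 * fps_X :: rat fps)) $ 0 = 0"
    by (simp add: fps_divide_unit)
  have "(fps_X / (1 - 4 * fps_X)) $ k * (fps_const (1 / fact i) * A_exponent ^ i) $ (n - k) = 0"
    if "k \<le> n" for k
  proof (cases "k = 0")
    case True
    then show ?thesis using f0 by simp
  next
    case False
    then have "n - k < i" using that assms by simp
    then show ?thesis using low by simp
  qed
  then show ?thesis
    unfolding alpha_tilde_def A_series_nth fps_mult_nth[of "fps_X / _"] by (intro sum.neutral) simp
qed

end

theory Submission
  imports Defs
begin

text \<open>Put $t = dQ/dx$. From $F' = tF^2$ and $t^2 = \Delta + 4Q$ one gets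
  $n\Delta F^{n+1} = 4nF^n + t\,(F^n)'$. As $t' = 2$, the functions $t^iF^{(i)}$ satisfy
  $t\,(t^iF^{(i)})' = 2i\,t^iF^{(i)} + t^{i+1}F^{(i+1)}$, so by induction on $n$ the claim reduces to
  the recurrence
  $n\,\tilde\alpha_{i,n+1} = (4n+2i)\,\tilde\alpha_{i,n} + \tilde\alpha_{i-1,n}$.
  For the generating function this is the differential equation
  $(1-4y)B_y = 4B + 2zB_z + zB$ of $B = A/y$, which holds because $g = \frac12((1-4y)^{-1/2}-1)$
  satisfies $(1-4y)g' = 2g + 1$.\<close>

text \<open>With s^2 = 1 - 4y and r = 1/s, differentiating \<open>s ^ 2\<close> and
  \<open>r * s = 1\<close> gives s s' = -2 and s^2 r' = 2r. The claim is half of the latter, since r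
  = 2g + 1.\<close>

lemma fps_deriv_A_exponent:
  "(1 - 4 * fps_X) * fps_deriv A_exponent = 2 * A_exponent + 1"
proof -
  define s :: "rat fps" where "s = sqrt_1_minus_4y"
  define r where "r = inverse s"
  have s0: "s $ 0 \<noteq> 0" and s2: "s ^ 2 = 1 - 4 * fps_X"
    by (simp_all add: s_def sqrt_1_minus_4y_nth_0 sqrt_1_minus_4y_power2)
  have rs: "r * s = 1"
    unfolding r_def using s0 by (rule inverse_mult_eq_1)
  have A: "A_exponent = fps_const (1 / 2) * (r - 1)"
    using s0 by (simp add: A_exponent_def r_def s_def fps_divide_unit)
  have "2 * fps_const (1 / 2 :: rat) = 1"
    by (simp add: numeral_fps_const)
  then have A2: "2 * A_exponent = r - 1"
    by (simp add: A flip: mult.assoc)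
  have "fps_deriv (s ^ 2) = - 4"
    unfolding s2 by (simp add: numeral_fps_const)
  then have "2 * (s * fps_deriv s) = 2 * (- 2)"
    by (simp add: power2_eq_square algebra_simps)
  then have ds: "s * fps_deriv s = - 2"
    using mult_left_cancel[of "2 :: rat fps"] zero_neq_numeral by metis
  have "fps_deriv (r * s) = 0"
    by (simp add: rs)
  then have "fps_deriv r * s = - (r * fps_deriv s)"
    by (simp add: algebra_simps eq_neg_iff_add_eq_0)
  then have "fps_deriv r * s * s = 2 * r"
    using ds by (simp add: algebra_simps)
  then have "s ^ 2 * fps_deriv r = 2 * r"
    by (simp add: power2_eq_square algebra_simps)
  then have "(1 - 4 * fps_X) * fps_deriv r = 2 * r"
    by (simp only: s2)
  moreover have "r = 2 * A_exponent + 1"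
    by (simp add: A2)
  moreover from this have "fps_deriv r = 2 * fps_deriv A_exponent"
    by simp
  ultimately have "2 * ((1 - 4 * fps_X) * fps_deriv A_exponent) = 2 * (2 * A_exponent + 1)"
    by (metis mult.left_commute)
  then show ?thesis
    using mult_left_cancel[of "2 :: rat fps"] zero_neq_numeral by metis
qed

text \<open>Compare the coefficients of z^i y^n in the differential equation for B = A/y; dividing
  by y shifts the second index by one. The \<open>if\<close> stands for the missing coefficient of
  z^(-1), as \<open>0 - 1 = 0\<close> on naturals.\<close>

lemma alpha_tilde_Suc_Suc:
  "of_nat (Suc n) * alpha_tilde i (Suc (Suc n)) =
    (4 * of_nat (Suc n) + 2 * of_nat i) * alpha_tilde i (Suc n)
    + (if i = 0 then 0 else alpha_tilde (i - 1) (Suc n))"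
proof -
  define u :: "rat fps" where "u = inverse (1 - 4 * fps_X)"
  \<comment> \<open>\<open>b i\<close> is the coefficient of z^i in B, a power series in y.\<close>
  define b where "b = (\<lambda>i. u * (fps_const (1 / fact i) * A_exponent ^ i))"
  have u: "u * (1 - 4 * fps_X) = 1"
    unfolding u_def by (rule inverse_mult_eq_1) simp
  have nth: "alpha_tilde i (Suc m) = b i $ m" for i m
    by (simp add: alpha_tilde_def A_series_nth b_def u_def fps_divide_unit mult.assoc)
  have "fps_deriv (u * (1 - 4 * fps_X)) = 0"
    by (simp add: u)
  then have "fps_deriv u * (1 - 4 * fps_X) = 4 * u"
    by (simp add: algebra_simps)
  then have du: "(1 - 4 * fps_X) * fps_deriv u = 4 * u"
    by (simp add: mult.commute)
  \<comment> \<open>The factor u contributes the 4. The factor g^i/i! contributes (2g + 1)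
    g^(i-1)/(i-1)!, which splits into 2i g^i/i! and the term of \<open>b (i - 1)\<close>.\<close>
  have ode: "(1 - 4 * fps_X) * fps_deriv (b i) =
      (4 + 2 * of_nat i) * b i + (if i = 0 then 0 else b (i - 1))"
  proof (cases i)
    case 0
    then show ?thesis using du by (simp add: b_def)
  next
    case (Suc k)
    define c :: "rat fps" where "c = fps_const (1 / fact i)"
    have c: "of_nat i * c = fps_const (1 / fact k)"
      by (simp add: c_def Suc fps_of_nat [symmetric] del: of_nat_Suc)
    have "fps_deriv (A_exponent ^ i) = of_nat i * fps_deriv A_exponent * A_exponent ^ k"
      by (simp add: Suc fps_deriv_power' del: of_nat_Suc power_Suc)
    then have "fps_deriv (b i) =
        fps_deriv u * (c * A_exponent ^ i) + u * (c * (of_nat i * fps_deriv A_exponent * A_exponent ^ k))"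
      by (simp add: b_def flip: c_def) (simp add: c_def algebra_simps)
    then have "(1 - 4 * fps_X) * fps_deriv (b i) =
        ((1 - 4 * fps_X) * fps_deriv u) * (c * A_exponent ^ i)
        + u * (c * (of_nat i * ((1 - 4 * fps_X) * fps_deriv A_exponent) * A_exponent ^ k))"
      by (simp add: algebra_simps)
    also have "\<dots> = (4 + 2 * of_nat i) * (u * (c * A_exponent ^ i)) + u * ((of_nat i * c) * A_exponent ^ k)"
      unfolding du fps_deriv_A_exponent by (simp add: Suc algebra_simps)
    finally show ?thesis
      unfolding c by (simp add: b_def c_def Suc)
  qed
  have nat_nth: "((4 + 2 * of_nat i) * b i) $ n = (4 + 2 * of_nat i) * b i $ n"
    by (simp add: numeral_fps_const fps_of_nat [symmetric])
  \<comment> \<open>Moved to the other side, the contribution of -4y turns 4 + 2i into 4(n + 1) +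
    2i.\<close>
  have "((1 - 4 * fps_X) * fps_deriv (b i)) $ n = of_nat (Suc n) * b i $ Suc n - 4 * of_nat n * b i $ n"
    by (cases n) (simp_all add: left_diff_distrib mult.assoc numeral_fps_const)
  then show ?thesis
    unfolding nth using arg_cong[OF ode, of "\<lambda>f. f $ n"] nat_nth
    by (simp add: nth algebra_simps split: if_splits)
qed

lemma ratfun_const_0 [simp]: "ratfun_const 0 = 0"
  and ratfun_const_1 [simp]: "ratfun_const 1 = 1"
  and ratfun_const_add: "ratfun_const (a + b) = ratfun_const a + ratfun_const b"
  and ratfun_const_mult: "ratfun_const (a * b) = ratfun_const a * ratfun_const b"
  and ratfun_const_eq_0_iff [simp]: "ratfun_const a = 0 \<longleftrightarrow> a = 0"
  by (simp_all add: ratfun_const_def flip: to_fract_add to_fract_mult one_pCons)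

lemma ratfun_const_of_nat: "ratfun_const (of_nat n) = of_nat n"
  by (induction n) (simp_all add: ratfun_const_add)

lemma ratfun_const_numeral: "ratfun_const (numeral k) = numeral k"
  using ratfun_const_of_nat[of "numeral k"] by simp

lemma fract_deriv_0 [simp]: "fract_deriv 0 = 0"
  using fract_deriv_to_fract[of 0] by simp

lemma fract_deriv_1 [simp]: "fract_deriv 1 = 0"
  using fract_deriv_to_fract[of 1] by simp

lemma fract_deriv_ratfun_const [simp]: "fract_deriv (ratfun_const c) = 0"
  by (simp add: ratfun_const_def fract_deriv_to_fract)

lemma fract_deriv_const_mult:
  "fract_deriv (ratfun_const c * r) = ratfun_const c * fract_deriv r"
  by (simp add: fract_deriv_mult)

lemma fract_deriv_sum: "fract_deriv (\<Sum>i\<in>I. f i) = (\<Sum>i\<in>I. fract_deriv (f i))"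
  by (induction I rule: infinite_finite_induct) (simp_all add: fract_deriv_add)

lemma fract_deriv_power:
  "fract_deriv (r ^ Suc n) = of_nat (Suc n) * r ^ n * fract_deriv r"
  by (induction n) (simp_all add: fract_deriv_mult algebra_simps)

text \<open>Multiplying the power rule by r removes the exponent n - 1, so that n = 0 is covered
  too.\<close>

lemma mult_fract_deriv_power:
  "r * fract_deriv (r ^ n) = of_nat n * r ^ n * fract_deriv r"
  by (cases n) (simp_all add: fract_deriv_power algebra_simps del: power_Suc of_nat_Suc, simp)

text \<open>Only differential relations between t and F enter: \<open>disc\<close> is t^2 = \<Delta>
  + 4Q times F = -1/Q, which eliminates Q. The power of \<Delta> stands on the left, so no division
  occurs, and n here is the theorem's n - 1.\<close>

lemma power_expansion:
  fixes F t :: "'a::field_char_0 poly fract" and \<Delta> :: 'a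
  assumes dt: "fract_deriv t = 2"
    and dF: "fract_deriv F = t * F\<^sup>2"
    and disc: "t\<^sup>2 * F = ratfun_const \<Delta> * F - 4"
  shows "ratfun_const \<Delta> ^ n * F ^ Suc n =
    (\<Sum>i\<le>n. ratfun_const (of_rat (alpha_tilde i (Suc n))) * (t ^ i * (fract_deriv ^^ i) F))"
proof (induction n)
  case 0
  have "alpha_tilde 0 (Suc 0) = 1"
    by (simp add: alpha_tilde_def A_series_nth fps_divide_unit)
  then show ?case
    by simp
next
  case (Suc n)
  define R where "R = (\<lambda>x. ratfun_const (of_rat x :: 'a))"
  define a where "a = (\<lambda>i m. R (alpha_tilde i m))"
  define w where "w = (\<lambda>i. t ^ i * (fract_deriv ^^ i) F)"
  define d where "d = ratfun_const \<Delta>"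
  define N :: "'a poly fract" where "N = of_nat (Suc n)"
  have R_simps: "R 0 = 0" "R (x + y) = R x + R y" "R (x * y) = R x * R y"
      "R (of_nat m) = of_nat m" "R (numeral k) = numeral k" for x y m k
    by (simp_all add: R_def of_rat_add of_rat_mult ratfun_const_add ratfun_const_mult
        ratfun_const_of_nat ratfun_const_numeral)
  \<comment> \<open>Characteristic zero passes from the coefficient field to the rational functions
    through the constants.\<close>
  have N: "N \<noteq> 0"
    unfolding N_def ratfun_const_of_nat [symmetric] by (simp del: of_nat_Suc)
  have IH: "d ^ n * F ^ Suc n = (\<Sum>i\<le>n. a i (Suc n) * w i)"
    using Suc by (simp add: d_def a_def w_def R_def)
  have tw: "t * fract_deriv (w i) = 2 * of_nat i * w i + w (Suc i)" for i
    using mult_fract_deriv_power[of t i]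
    by (simp add: w_def fract_deriv_mult dt algebra_simps)
  have rec: "N * a i (Suc (Suc n)) =
      (4 * N + 2 * of_nat i) * a i (Suc n) + (if i = 0 then 0 else a (i - 1) (Suc n))" for i
    using arg_cong[OF alpha_tilde_Suc_Suc[of n i], of R]
    by (simp add: a_def N_def R_simps split: if_splits del: of_nat_Suc)
  \<comment> \<open>This zero coefficient allows the sum up to n to be extended to n + 1
    below.\<close>
  have top: "a (Suc n) (Suc n) = 0"
    by (simp add: a_def alpha_tilde_eq_0 R_simps)
  have dpow: "fract_deriv (d ^ n * r) = d ^ n * fract_deriv r" for r
  proof -
    have "d * fract_deriv (d ^ n) = 0"
      by (simp add: mult_fract_deriv_power d_def)
    then show ?thesis
      by (cases n) (auto simp: fract_deriv_mult d_def fract_deriv_power simp del: power_Suc)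
  qed
  have "N * (d ^ Suc n * F ^ Suc (Suc n)) = N * d ^ n * F ^ Suc n * (d * F)"
    by (simp add: algebra_simps)
  also have "d * F = 4 + t\<^sup>2 * F"
    by (simp add: disc d_def)
  also have "N * d ^ n * F ^ Suc n * (4 + t\<^sup>2 * F) =
      4 * N * (d ^ n * F ^ Suc n) + t * (d ^ n * (N * F ^ n * (t * F\<^sup>2)))"
    by (simp add: algebra_simps power2_eq_square)
  \<comment> \<open>By \<open>dF\<close>, the factor N F^n (t F^2) is the derivative of F^(n+1), and
    the constant d^n moves under the derivation.\<close>
  also have "\<dots> = 4 * N * (d ^ n * F ^ Suc n) + t * fract_deriv (d ^ n * F ^ Suc n)"
    by (simp only: dpow fract_deriv_power N_def dF)
  also have "\<dots> = 4 * N * (\<Sum>i\<le>n. a i (Suc n) * w i) + (\<Sum>i\<le>n. a i (Suc n) * (t * fract_deriv (w i)))"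
    unfolding IH
    by (simp add: fract_deriv_sum a_def R_def fract_deriv_const_mult sum_distrib_left mult.left_commute)
  also have "\<dots> = (\<Sum>i\<le>n. (4 * N + 2 * of_nat i) * a i (Suc n) * w i) + (\<Sum>i\<le>n. a i (Suc n) * w (Suc i))"
    by (simp add: tw sum_distrib_left algebra_simps sum.distrib)
  also have "(\<Sum>i\<le>n. (4 * N + 2 * of_nat i) * a i (Suc n) * w i) =
      (\<Sum>i\<le>Suc n. (4 * N + 2 * of_nat i) * a i (Suc n) * w i)"
    by (simp add: top)
  \<comment> \<open>Shift the index and pad with a zero term at i = 0; both sums then share a range,
    and \<open>rec\<close> merges them termwise.\<close>
  also have "(\<Sum>i\<le>n. a i (Suc n) * w (Suc i)) =
      (\<Sum>i\<le>Suc n. (if i = 0 then 0 else a (i - 1) (Suc n)) * w i)"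
    by (simp add: sum.atMost_Suc_shift del: sum.atMost_Suc)
  also have "(\<Sum>i\<le>Suc n. (4 * N + 2 * of_nat i) * a i (Suc n) * w i) + \<dots> =
      N * (\<Sum>i\<le>Suc n. a i (Suc (Suc n)) * w i)"
    by (simp only: sum_distrib_left sum.distrib [symmetric] distrib_right [symmetric]
        rec [symmetric] mult.assoc [symmetric])
  finally have "d ^ Suc n * F ^ Suc (Suc n) = (\<Sum>i\<le>Suc n. a i (Suc (Suc n)) * w i)"
    using N by (metis mult_left_cancel)
  then show ?case
    by (simp only: d_def a_def w_def R_def)
qed

theorem theorem1:
  fixes p q \<Delta> :: complex and Q :: "complex poly" and F :: "complex poly fract"
  assumes Q: "Q = [:q, -p, 1:]"
    and distinct_roots: "card {x. poly Q x = 0} = 2"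
    and \<Delta>: "\<Delta> = p\<^sup>2 - 4 * q"
    and F: "F = - (1 / to_fract Q)"
  shows "\<forall>n\<ge>1. F ^ n =
    (\<Sum>i = 0..n - 1.
      (to_fract (pderiv Q) ^ i / ratfun_const \<Delta> ^ (n - 1) * ratfun_const (of_rat (alpha_tilde i n)))
      * (fract_deriv ^^ i) F)"
proof (intro allI impI)
  fix n :: nat
  assume "1 \<le> n"
  then obtain m where n: "n = Suc m"
    by (cases n) auto
  define t where "t = to_fract (pderiv Q)"
  define f where "f = to_fract Q"
  have "\<Delta> \<noteq> 0"
  \<comment> \<open>With zero discriminant, Q would be (x - p/2)^2, which has a single root.\<close>
  proof
    assume "\<Delta> = 0"
    then have "q = (p / 2)\<^sup>2"
      using \<Delta> by (simp add: power_divide)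
    then have "poly Q x = (x - p / 2)\<^sup>2" for x
      by (simp add: Q power2_eq_square algebra_simps)
    then have "{x. poly Q x = 0} = {p / 2}"
      by auto
    then show False
      using distinct_roots by simp
  qed
  then have d: "ratfun_const \<Delta> \<noteq> 0"
    by simp
  have f: "f \<noteq> 0"
    by (simp add: f_def Q)
  have F': "F = - (1 / f)"
    by (simp add: F f_def)
  have "pderiv (pderiv Q) = [:2:]"
    by (simp add: Q pderiv_pCons)
  then have dt: "fract_deriv t = 2"
    using ratfun_const_numeral[of "num.Bit0 num.One", where ?'a = complex]
    by (simp add: t_def fract_deriv_to_fract ratfun_const_def)
  \<comment> \<open>Differentiating QF = -1 gives QF' = -tF; dividing by Q and using 1/Q = -F yields
    F' = tF^2.\<close>
  have "fract_deriv (f * F + 1) = 0"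
    using f by (simp add: F')
  then have "f * fract_deriv F = - (t * F)"
    by (simp add: fract_deriv_add fract_deriv_mult eq_neg_iff_add_eq_0 t_def f_def fract_deriv_to_fract add.commute)
  then have dF: "fract_deriv F = t * F\<^sup>2"
    using f by (simp add: F' field_simps power2_eq_square)
  \<comment> \<open>This is (2x - p)^2 = \<Delta> + 4Q; multiplied by F, with QF = -1, it becomes
    \<open>disc\<close>.\<close>
  have "(pderiv Q)\<^sup>2 = [:\<Delta>:] + [:4:] * Q"
    by (simp add: Q \<Delta> pderiv_pCons power2_eq_square algebra_simps)
  then have "t\<^sup>2 = ratfun_const \<Delta> + ratfun_const 4 * f"
    unfolding t_def f_def ratfun_const_def
    by (simp only: power2_eq_square flip: to_fract_mult to_fract_add)
  then have disc: "t\<^sup>2 * F = ratfun_const \<Delta> * F - 4"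
    using f by (simp add: F' ratfun_const_numeral field_simps)
  show "F ^ n =
    (\<Sum>i = 0..n - 1.
      (to_fract (pderiv Q) ^ i / ratfun_const \<Delta> ^ (n - 1) * ratfun_const (of_rat (alpha_tilde i n)))
      * (fract_deriv ^^ i) F)"
  proof -
    have "F ^ n = ratfun_const \<Delta> ^ m * F ^ Suc m / ratfun_const \<Delta> ^ m"
      using d by (simp add: n)
    then show ?thesis
      unfolding power_expansion[OF dt dF disc] t_def
      by (simp add: n sum_divide_distrib atMost_atLeast0 mult_ac)
  qed
qed

end
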